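(* Let $\phi=f+h$ on $\mathbb{R}^n$, where $f:\mathbb{R}^n\to\mathbb{R}$ is convex and differentiable with gradient Lipschitz continuous with constant $L>0$, and $h:\mathbb{R}^n\to\mathbb{R}$ is convex (possibly non-smooth). Suppose the stochastic gradient $G(x,\xi)$ satisfies $\mathbb{E}\,G(x,\xi)=\nabla f(x)$ and $\mathbb{E}\|\nabla f(x)-G(x,\xi)\|^2\le\sigma^2$ for all $x\in\mathbb{R}^n$, where $\sigma\geq 0$ is a constant. Let $x^*$ be an optimal solution of $\min_{x}\phi(x)$, let $N\ge 1$ be an integer, and let $x_{N+1}$ be the output of Algorithm SG (defined in the context) run with inputs $N$ and $L$. Then $$\mathbb{E}\left(\phi(x_{N+1})-\phi(x^* )\right)\leq\frac{2D^2+\sigma^2}{(N+2)^{\frac{1}{2}}}+L\,\frac{4D^2+2\sigma^2}{(N+2)^2},$$ where $D=\|x^*-z_0\|$ and $z_0=0$ is the starting point of the algorithm.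
   Context: Here $\|\cdot\|$ is the Euclidean norm and $\langle\cdot,\cdot\rangle$ the Euclidean inner product on $\mathbb{R}^n$. The function $f$ is of the form $f(x)=\mathbb{E}F(x,\xi)$ for a random variable $\xi$, and $G(x,\xi)$ is a random vector in $\mathbb{R}^n$ determined by $x$ and $\xi$ (a stochastic gradient of $f$ at $x$); expectations in the hypotheses on $G$ are over $\xi$, with $x$ fixed. Algorithm SG (inputs: $N$ and $L$). Set $\theta_t=\frac{2}{t+2}$ and $\gamma_t=\frac{2}{t+2}\left(\frac{N^{3/2}}{L}+2\right)$ for $t=0,1,\dots,N$. Set $x_0=0$ and $z_0=0$. For $t=0,1,\dots,N$: 1. $y_t=(1-\theta_t)x_t+\theta_t z_t$; 2. generate $\xi_t$ from the distribution of $\xi$, independently of the previously generated $\xi_0,\dots,\xi_{t-1}$; 3. $z_{t+1}=\operatorname{arg\,min}_{x\in\mathbb{R}^n}\left\{\langle x,G(y_t,\xi_t)\rangle+\frac{\gamma_t L}{2}\|x-z_t\|^2+h(x)\right\}$; 4. $x_{t+1}=(1-\theta_t)x_t+\theta_t z_{t+1}$. Output: $x_{N+1}$. The expectation in the conclusion is over $\xi_0,\dots,\xi_N$. *)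

theory Defs
  imports "HOL-Probability.Probability"
begin

definition sg_theta :: "nat \<Rightarrow> real" where
  "sg_theta t = 2 / (real t + 2)"

definition sg_gamma :: "nat \<Rightarrow> real \<Rightarrow> nat \<Rightarrow> real" where
  "sg_gamma N L t = 2 / (real t + 2) * (real N powr (3/2) / L + 2)"

(* For convex h and positive step parameter g * L the objective is strongly convex and
   finite-valued, so the minimizer exists and is unique: the choice made by arg_min is immaterial. *)
definition sg_prox :: "real \<Rightarrow> real \<Rightarrow> (real ^ 'n \<Rightarrow> real) \<Rightarrow> real ^ 'n \<Rightarrow> real ^ 'n \<Rightarrow> real ^ 'n" where
  "sg_prox g L h v z =
     arg_min (\<lambda>x. x \<bullet> v + g * L / 2 * (norm (x - z))\<^sup>2 + h x) (\<lambda>_. True)"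

(* The pair (x_t, z_t) of Algorithm SG when the samples drawn are s 0, s 1, ... *)
primrec sg_state ::
  "nat \<Rightarrow> real \<Rightarrow> (real ^ 'n \<Rightarrow> real) \<Rightarrow> (real ^ 'n \<Rightarrow> 's \<Rightarrow> real ^ 'n) \<Rightarrow> (nat \<Rightarrow> 's) \<Rightarrow> nat
     \<Rightarrow> (real ^ 'n) \<times> (real ^ 'n)" where
  "sg_state N L h G s 0 = (0, 0)"
| "sg_state N L h G s (Suc t) =
     (let (x, z) = sg_state N L h G s t;
          y = (1 - sg_theta t) *\<^sub>R x + sg_theta t *\<^sub>R z;
          z' = sg_prox (sg_gamma N L t) L h (G y (s t)) z;
          x' = (1 - sg_theta t) *\<^sub>R x + sg_theta t *\<^sub>R z'
      in (x', z'))"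

definition sg_output ::
  "nat \<Rightarrow> real \<Rightarrow> (real ^ 'n \<Rightarrow> real) \<Rightarrow> (real ^ 'n \<Rightarrow> 's \<Rightarrow> real ^ 'n) \<Rightarrow> (nat \<Rightarrow> 's) \<Rightarrow> real ^ 'n" where
  "sg_output N L h G s = fst (sg_state N L h G s (N + 1))"

end

theory Submission
  imports Defs
begin

text \<open>Let \<open>w\<close> be the optimal solution, let \<open>\<delta>\<^sub>t\<close> be the error of the stochastic gradient at time \<open>t\<close>, and put
  \<open>E\<^sub>t = \<phi> x\<^sub>t - \<phi> w\<close>, \<open>u\<^sub>t = w - z\<^sub>t\<close>, \<open>k\<^sub>t = (t + 2) / 2\<close>, \<open>c = N\<^bsup>3/2\<^esup> + 2 L\<close> and \<open>b = N\<^bsup>3/2\<^esup> + L\<close>. Smoothness and convexity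
  of \<open>f\<close> at \<open>y\<^sub>t\<close>, together with the optimality of the proximal point \<open>z\<^sub>t\<^sub>+\<^sub>1\<close>, give for every outcome of the samples

    \<open>k\<^sub>t\<^sup>2 E\<^sub>t\<^sub>+\<^sub>1 \<le> t (t + 2) / 4 E\<^sub>t + c / 2 (|u\<^sub>t|\<^sup>2 - |u\<^sub>t\<^sub>+\<^sub>1|\<^sup>2) + k\<^sub>t \<langle>\<delta>\<^sub>t, u\<^sub>t\<^sub>+\<^sub>1\<rangle> - b / 2 |u\<^sub>t\<^sub>+\<^sub>1 - u\<^sub>t|\<^sup>2\<close>

  (\<open>sg_one_step\<close>, in scaled form \<open>one_step\<close>). The last term pays for replacing \<open>\<langle>\<delta>\<^sub>t, u\<^sub>t\<^sub>+\<^sub>1\<rangle>\<close> by \<open>\<langle>\<delta>\<^sub>t, u\<^sub>t\<rangle>\<close> at the cost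
  \<open>k\<^sub>t\<^sup>2 |\<delta>\<^sub>t|\<^sup>2 / (2 b)\<close>. As \<open>u\<^sub>t\<close> depends on earlier samples only, \<open>\<langle>\<delta>\<^sub>t, u\<^sub>t\<rangle>\<close> has expectation zero and \<open>|\<delta>\<^sub>t|\<^sup>2\<close>
  has expectation at most \<open>\<sigma>\<^sup>2\<close> (\<open>independent_centred_noise\<close>). Hence the expectation of the potential
  \<open>t (t + 2) / 4 E\<^sub>t + c / 2 |u\<^sub>t|\<^sup>2\<close> grows by at most \<open>k\<^sub>t\<^sup>2 \<sigma>\<^sup>2 / (2 b)\<close> per step (\<open>expected_potential\<close>).

  Discarding \<open>|u\<^sub>N\<^sub>+\<^sub>1|\<^sup>2\<close> after the last step would give the stated rate for \<open>N \<ge> 2\<close>, but for \<open>N = 1\<close> and small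
  \<open>L\<close> the constant in front of \<open>\<sigma>\<^sup>2\<close> would be too large. In the last step this term is therefore used, too, to
  absorb noise, which halves the cost of that step (\<open>noise_absorption_last\<close>, \<open>expected_gap\<close>). What remains is an
  elementary estimate in \<open>N\<close> (\<open>rate_arithmetic\<close>), in which \<open>b\<close> is bounded below by \<open>N\<^bsup>3/2\<^esup>\<close>.

  Apart from the inequality, the iterates have to be random variables. Proximal points exist by coercivity and
  depend on the data in a Lipschitz way (\<open>prox_minimizer_lipschitz\<close>), so the state at time \<open>t\<close> is a measurable
  function of the samples before \<open>t\<close> (\<open>sg_state_measurable\<close>).\<close>

section \<open>Smooth convex functions\<close>

text \<open>Both first-order bounds for \<open>f\<close> reduce to one variable by restricting to a line.\<close>

lemma GDERIV_along_line:
  fixes f :: "'a::real_inner \<Rightarrow> real"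
  assumes "\<And>x. GDERIV f x :> grad x"
  shows "((\<lambda>s. f (y + s *\<^sub>R d)) has_real_derivative grad (y + s *\<^sub>R d) \<bullet> d) (at s within S)"
proof -
  have "((\<lambda>s. f (y + s *\<^sub>R d)) has_derivative (\<lambda>r. (r *\<^sub>R d) \<bullet> grad (y + s *\<^sub>R d))) (at s within S)"
    by (rule has_derivative_compose[OF _ assms[unfolded gderiv_def]])
       (auto intro!: derivative_eq_intros)
  then show ?thesis
    by (simp add: has_field_derivative_def inner_commute mult.commute[of _ "d \<bullet> _"])
qed

lemma convex_gradient_minorant:
  fixes f :: "'a::real_inner \<Rightarrow> real"
  assumes conv: "convex_on UNIV f" and grad: "\<And>x. GDERIV f x :> grad x"
  shows "f y + grad y \<bullet> (x - y) \<le> f x"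
proof -
  let ?k = "\<lambda>s. f (y + s *\<^sub>R (x - y))"
  have "convex_on UNIV ?k"
  proof (rule convex_onI)
    fix t a b :: real
    assume t: "0 < t" "t < 1"
    have "y + ((1 - t) * a + t * b) *\<^sub>R (x - y)
        = (1 - t) *\<^sub>R (y + a *\<^sub>R (x - y)) + t *\<^sub>R (y + b *\<^sub>R (x - y))"
      by (simp add: algebra_simps)
    then show "?k ((1 - t) *\<^sub>R a + t *\<^sub>R b) \<le> (1 - t) * ?k a + t * ?k b"
      using convex_onD[OF conv, of t "y + a *\<^sub>R (x - y)" "y + b *\<^sub>R (x - y)"] t by simp
  qed simp
  moreover have "(?k has_real_derivative grad y \<bullet> (x - y)) (at 0)"
    using GDERIV_along_line[of f grad y "x - y" 0 UNIV, OF grad] by simp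
  ultimately have "?k 1 - ?k 0 \<ge> grad y \<bullet> (x - y) * (1 - 0)"
    by (intro convex_on_imp_above_tangent[where A = UNIV]) auto
  then show ?thesis by simp
qed

lemma lipschitz_gradient_majorant:
  fixes f :: "'a::real_inner \<Rightarrow> real"
  assumes grad: "\<And>x. GDERIV f x :> grad x" and lip: "L-lipschitz_on UNIV grad"
  shows "f x \<le> f y + grad y \<bullet> (x - y) + L / 2 * (norm (x - y))\<^sup>2"
proof -
  define d where "d = x - y"
  let ?k = "\<lambda>s. f (y + s *\<^sub>R d) - s * (grad y \<bullet> d) - L / 2 * s\<^sup>2 * (norm d)\<^sup>2"
  have "?k 1 \<le> ?k 0"
  proof (rule DERIV_nonpos_imp_nonincreasing[of 0 1 ?k])
    fix s :: real
    assume s: "0 \<le> s" "s \<le> 1"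
    have "(?k has_real_derivative grad (y + s *\<^sub>R d) \<bullet> d - grad y \<bullet> d - L * s * (norm d)\<^sup>2) (at s)"
      by (auto intro!: derivative_eq_intros GDERIV_along_line[OF grad])
    moreover have "(grad (y + s *\<^sub>R d) - grad y) \<bullet> d \<le> L * s * (norm d)\<^sup>2"
    proof -
      have "norm (grad (y + s *\<^sub>R d) - grad y) \<le> L * (s * norm d)"
        using lipschitz_onD[OF lip, of "y + s *\<^sub>R d" y] s by (simp add: dist_norm)
      then have "norm (grad (y + s *\<^sub>R d) - grad y) * norm d \<le> L * (s * norm d) * norm d"
        by (rule mult_right_mono) simp
      with norm_cauchy_schwarz[of "grad (y + s *\<^sub>R d) - grad y" d] show ?thesis
        by (simp add: power2_eq_square algebra_simps)
    qed
    ultimately show "\<exists>m. (?k has_real_derivative m) (at s) \<and> m \<le> 0"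
      by (intro exI conjI) (auto simp: inner_diff_left)
  qed simp
  then show ?thesis by (simp add: d_def)
qed

section \<open>The proximal map of a finite convex function\<close>

text \<open>A finite convex function decreases at most linearly. Being continuous, it is bounded below on the unit
  ball, and convexity along the segment from \<open>0\<close> to a far point \<open>x\<close> carries the bound at
  \<open>x / norm x\<close> over to \<open>x\<close>, at the price of a factor \<open>norm x\<close>. This is the coercivity behind the
  existence of proximal points.\<close>

lemma convex_minorant_norm:
  fixes h :: "'a::euclidean_space \<Rightarrow> real"
  assumes conv: "convex_on UNIV h"
  obtains K where "K \<ge> 0" "\<And>x. h x \<ge> - K * (1 + norm x)"
proof -
  have cont: "continuous_on (cball 0 1) h"
    using convex_on_continuous[OF open_UNIV conv] continuous_on_subset by blast
  then obtain a where a: "\<And>x. norm x \<le> 1 \<Longrightarrow> h a \<le> h x"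
    using continuous_attains_inf[of "cball 0 1" h] by (auto simp: Ball_def)
  define K where "K = \<bar>h a\<bar> + \<bar>h 0\<bar>"
  have "h x \<ge> - K * (1 + norm x)" for x
  proof (cases "norm x \<le> 1")
    case True
    have "K * (1 + norm x) \<ge> K * 1" by (rule mult_left_mono) (auto simp: K_def)
    moreover have "h a \<ge> - K" by (simp add: K_def)
    ultimately show ?thesis using a[OF True] by simp
  next
    case False
    define r where "r = norm x"
    have r: "r > 1" using False by (simp add: r_def)
    have "h ((1 - 1/r) *\<^sub>R 0 + (1/r) *\<^sub>R x) \<le> (1 - 1/r) * h 0 + (1/r) * h x"
      using r by (intro convex_onD[OF conv]) auto
    then have "r * h ((1/r) *\<^sub>R x) \<le> (r - 1) * h 0 + h x"
      using r by (simp add: field_simps)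
    moreover have "h a \<le> h ((1/r) *\<^sub>R x)" by (rule a) (use r in \<open>auto simp: r_def\<close>)
    then have "r * h a \<le> r * h ((1/r) *\<^sub>R x)" using r by simp
    moreover have "(r - 1) * h 0 \<le> (r - 1) * \<bar>h 0\<bar>"
      using r by (intro mult_left_mono) auto
    moreover have "r * h a \<ge> r * (- \<bar>h a\<bar>)" using r by (intro mult_left_mono) auto
    moreover have "K * (1 + r) \<ge> K * r" by (intro mult_left_mono) (auto simp: K_def)
    ultimately show ?thesis unfolding r_def[symmetric] by (simp add: K_def algebra_simps)
  qed
  moreover have "K \<ge> 0" by (simp add: K_def)
  ultimately show ?thesis using that by blast
qed

text \<open>The quadratic term beats the linear lower bound for \<open>h\<close>, so outside a large ball the objective exceeds
  its value at \<open>z\<close>, and a minimum over the compact ball is global.\<close>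

lemma prox_minimizer_exists:
  fixes h :: "'a::euclidean_space \<Rightarrow> real"
  assumes conv: "convex_on UNIV h" and \<mu>: "\<mu> > 0"
  shows "\<exists>p. is_arg_min (\<lambda>x. x \<bullet> v + \<mu> / 2 * (norm (x - z))\<^sup>2 + h x) (\<lambda>_. True) p"
proof -
  let ?o = "\<lambda>x. x \<bullet> v + \<mu> / 2 * (norm (x - z))\<^sup>2 + h x"
  obtain K where K: "K \<ge> 0" "\<And>x. h x \<ge> - K * (1 + norm x)"
    using convex_minorant_norm[OF conv] by blast
  define C where "C = K * (1 + norm z) + norm z * norm v + \<bar>?o z\<bar>"
  define B where "B = K + norm v"
  \<comment> \<open>At distance \<open>r \<ge> R\<close> from \<open>z\<close> the quadratic term is at least \<open>(B + C) * r\<close>, while the other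
    terms lose at most \<open>B * r + C\<close>.\<close>
  define R where "R = 1 + 2 * (B + C) / \<mu>"
  have C0: "C \<ge> 0" and B0: "B \<ge> 0" using K by (auto simp: C_def B_def)
  have R1: "R \<ge> 1" using B0 C0 \<mu> by (simp add: R_def)
  have far: "?o z \<le> ?o x" if x: "norm (x - z) > R" for x
  proof -
    define r where "r = norm (x - z)"
    have r: "r > R" using x by (simp add: r_def)
    have nx: "norm x \<le> norm z + r" unfolding r_def by norm
    have "x \<bullet> v \<ge> - (norm x * norm v)" using Cauchy_Schwarz_ineq2[of x v] by linarith
    moreover have "norm x * norm v \<le> (norm z + r) * norm v"
      using nx by (rule mult_right_mono) simp
    moreover have "K * (1 + norm x) \<le> K * (1 + norm z + r)"
      using nx K(1) by (intro mult_left_mono) auto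
    ultimately have "?o x \<ge> \<mu> / 2 * r\<^sup>2 - B * r - (C - \<bar>?o z\<bar>)"
      using K(2)[of x] by (simp add: C_def B_def r_def[symmetric] algebra_simps)
    moreover have "\<mu> / 2 * r\<^sup>2 \<ge> (B + C) * r"
    proof -
      have "\<mu> / 2 * r \<ge> \<mu> / 2 * (2 * (B + C) / \<mu>)" 
        using r \<mu> by (intro mult_left_mono) (auto simp: R_def)
      then have "\<mu> / 2 * r \<ge> B + C" using \<mu> by simp
      from mult_right_mono[OF this, of r] r R1 show ?thesis
        by (simp add: power2_eq_square)
    qed
    moreover have "C * r \<ge> C" using C0 r R1 mult_left_mono[of 1 r C] by simp
    ultimately show ?thesis by (simp add: algebra_simps)
  qed
  have "continuous_on (cball z R) h"
    using convex_on_continuous[OF open_UNIV conv] continuous_on_subset by blast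
  then have "continuous_on (cball z R) ?o"
    by (intro continuous_intros)
  then obtain p where p: "p \<in> cball z R" "\<And>x. x \<in> cball z R \<Longrightarrow> ?o p \<le> ?o x"
    using continuous_attains_inf[of "cball z R" ?o] R1 by auto
  have "?o p \<le> ?o x" for x
  proof (cases "x \<in> cball z R")
    case True
    then show ?thesis by (rule p)
  next
    case False
    then have "?o z \<le> ?o x" by (intro far) (simp add: dist_norm norm_minus_commute)
    moreover have "?o p \<le> ?o z" using R1 by (intro p) simp
    ultimately show ?thesis by linarith
  qed
  then show ?thesis by (auto simp: is_arg_min_linorder)
qed

text \<open>Optimality of \<open>p\<close> is tested against \<open>p + s (x - p)\<close>. The first-order part of the comparison is \<open>s\<close>
  times the expression below and the rest is of order \<open>s\<^sup>2\<close>, so a negative value is refuted by a small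
  \<open>s\<close>. Since this never differentiates \<open>h\<close>, it replaces a subgradient condition.\<close>

lemma prox_variational_inequality:
  fixes h :: "'a::real_inner \<Rightarrow> real"
  assumes conv: "convex_on UNIV h"
    and min: "is_arg_min (\<lambda>x. x \<bullet> v + \<mu> / 2 * (norm (x - z))\<^sup>2 + h x) (\<lambda>_. True) p"
  shows "0 \<le> (x - p) \<bullet> v + \<mu> * ((p - z) \<bullet> (x - p)) + h x - h p" (is "0 \<le> ?A")
proof (rule ccontr)
  assume neg: "\<not> 0 \<le> ?A"
  define B where "B = \<mu> / 2 * (norm (x - p))\<^sup>2"
  have step: "0 \<le> ?A + s * B" if s: "0 < s" "s \<le> 1" for s
  proof -
    have "p \<bullet> v + \<mu> / 2 * (norm (p - z))\<^sup>2 + h p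
      \<le> (p + s *\<^sub>R (x - p)) \<bullet> v + \<mu> / 2 * (norm (p + s *\<^sub>R (x - p) - z))\<^sup>2 + h (p + s *\<^sub>R (x - p))"
      using min by (simp add: is_arg_min_linorder)
    moreover have "h (p + s *\<^sub>R (x - p)) \<le> (1 - s) * h p + s * h x"
    proof -
      have "p + s *\<^sub>R (x - p) = (1 - s) *\<^sub>R p + s *\<^sub>R x" by (simp add: algebra_simps)
      then show ?thesis using convex_onD[OF conv, of s p x] s by simp
    qed
    moreover have "(norm (p + s *\<^sub>R (x - p) - z))\<^sup>2
        = (norm (p - z))\<^sup>2 + 2 * s * ((p - z) \<bullet> (x - p)) + s\<^sup>2 * (norm (x - p))\<^sup>2"
      unfolding power2_norm_eq_inner
      by (simp add: inner_simps power2_eq_square inner_commute algebra_simps)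
    moreover have "(p + s *\<^sub>R (x - p)) \<bullet> v = p \<bullet> v + s * ((x - p) \<bullet> v)"
      by (simp add: inner_simps)
    ultimately have "p \<bullet> v + \<mu> / 2 * (norm (p - z))\<^sup>2 + h p \<le> p \<bullet> v + s * ((x - p) \<bullet> v)
        + \<mu> / 2 * ((norm (p - z))\<^sup>2 + 2 * s * ((p - z) \<bullet> (x - p)) + s\<^sup>2 * (norm (x - p))\<^sup>2)
        + ((1 - s) * h p + s * h x)" by simp
    then have "0 \<le> s * (?A + s * B)"
      unfolding B_def by (simp add: power2_eq_square distrib_left distrib_right left_diff_distrib right_diff_distrib mult_ac)
    then show ?thesis using s by (simp add: zero_le_mult_iff)
  qed
  \<comment> \<open>Small enough that the second-order term uses up at most half of \<open>- ?A\<close>.\<close>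
  define s where "s = min 1 (- ?A / (2 * (\<bar>B\<bar> + 1)))"
  have s: "0 < s" "s \<le> 1" using neg by (auto simp: s_def intro!: divide_neg_pos)
  have "s * (2 * (\<bar>B\<bar> + 1)) \<le> - ?A"
    by (subst pos_le_divide_eq[symmetric]) (auto simp: s_def)
  moreover have "s * B \<le> s * (\<bar>B\<bar> + 1)" using s by (intro mult_left_mono) auto
  ultimately show False using step[OF s] neg by (simp add: algebra_simps)
qed

text \<open>Testing each of two proximal points against the other and adding the variational inequalities cancels
  \<open>h\<close>. Continuity in \<open>v\<close> and \<open>z\<close> is what makes the iterates measurable.\<close>

lemma prox_minimizer_lipschitz:
  fixes h :: "'a::real_inner \<Rightarrow> real"
  assumes conv: "convex_on UNIV h" and \<mu>: "\<mu> > 0"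
    and p: "is_arg_min (\<lambda>x. x \<bullet> v + \<mu> / 2 * (norm (x - z))\<^sup>2 + h x) (\<lambda>_. True) p"
    and p': "is_arg_min (\<lambda>x. x \<bullet> v' + \<mu> / 2 * (norm (x - z'))\<^sup>2 + h x) (\<lambda>_. True) p'"
  shows "norm (p - p') \<le> norm (z - z') + norm (v - v') / \<mu>"
proof -
  let ?w = "\<mu> *\<^sub>R (z - z') - (v - v')"
  have "\<mu> * (norm (p - p'))\<^sup>2 \<le> (p - p') \<bullet> ?w"
    using prox_variational_inequality[OF conv p, of p'] prox_variational_inequality[OF conv p', of p]
    unfolding power2_norm_eq_inner by (simp add: inner_simps inner_commute algebra_simps)
  also have "\<dots> \<le> norm (p - p') * norm ?w" by (rule norm_cauchy_schwarz)
  finally have "norm (p - p') * (\<mu> * norm (p - p')) \<le> norm (p - p') * norm ?w"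
    by (simp add: power2_eq_square mult_ac)
  then have "\<mu> * norm (p - p') \<le> norm ?w"
    by (cases "p = p'") (auto simp: mult_le_cancel_left)
  also have "\<dots> \<le> \<mu> * norm (z - z') + norm (v - v')"
    using norm_triangle_ineq4[of "\<mu> *\<^sub>R (z - z')" "v - v'"] \<mu> by simp
  finally show ?thesis using \<mu> by (simp add: field_simps)
qed

lemma sg_prox_is_arg_min:
  assumes "convex_on UNIV h" "g * L > 0"
  shows "is_arg_min (\<lambda>x. x \<bullet> v + g * L / 2 * (norm (x - z))\<^sup>2 + h x) (\<lambda>_. True) (sg_prox g L h v z)"
  unfolding sg_prox_def arg_min_def by (rule someI_ex, rule prox_minimizer_exists[OF assms])

lemma continuous_on_sg_prox:
  fixes h :: "real ^ 'n \<Rightarrow> real"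
  assumes h: "convex_on UNIV h" and gL: "g * L > 0"
  shows "continuous_on UNIV (\<lambda>q. sg_prox g L h (fst q) (snd q))"
proof (rule lipschitz_on_continuous_on[of "1 + 1 / (g * L)"], rule lipschitz_onI)
  fix q q' :: "(real ^ 'n) \<times> (real ^ 'n)"
  have "dist (sg_prox g L h (fst q) (snd q)) (sg_prox g L h (fst q') (snd q'))
      \<le> dist (snd q) (snd q') + dist (fst q) (fst q') / (g * L)"
    using prox_minimizer_lipschitz[OF h gL sg_prox_is_arg_min[OF h gL] sg_prox_is_arg_min[OF h gL]]
    by (simp add: dist_norm)
  also have "\<dots> \<le> dist q q' + dist q q' / (g * L)"
    using gL by (intro add_mono divide_right_mono dist_fst_le dist_snd_le) auto
  finally show "dist (sg_prox g L h (fst q) (snd q)) (sg_prox g L h (fst q') (snd q'))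
      \<le> (1 + 1 / (g * L)) * dist q q'" by (simp add: algebra_simps)
qed (use gL in auto)

section \<open>One step of the algorithm\<close>

text \<open>The smoothness bound is expanded around \<open>y\<close>. Because \<open>x' - y = \<theta> (z' - z)\<close>, its quadratic part costs
  only \<open>\<theta>\<^sup>2\<close>, and its linear part splits into a share of \<open>x\<close>, absorbed by convexity of \<open>f\<close>, and a share of
  \<open>z'\<close>, controlled by the variational inequality at \<open>z'\<close>. Replacing the true gradient by \<open>g\<close> in the
  latter leaves the error term \<open>(g - grad y) \<bullet> (w - z')\<close>.\<close>

lemma sg_one_step:
  fixes f h :: "'a::real_inner \<Rightarrow> real"
  assumes f: "convex_on UNIV f" and grad: "\<And>x. GDERIV f x :> grad x"
    and lip: "L-lipschitz_on UNIV grad" and h: "convex_on UNIV h"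
    and \<theta>: "0 \<le> \<theta>" "\<theta> \<le> 1"
    and y: "y = (1 - \<theta>) *\<^sub>R x + \<theta> *\<^sub>R z" and x': "x' = (1 - \<theta>) *\<^sub>R x + \<theta> *\<^sub>R z'"
    and z': "is_arg_min (\<lambda>x. x \<bullet> g + \<gamma> * L / 2 * (norm (x - z))\<^sup>2 + h x) (\<lambda>_. True) z'"
  shows "f x' + h x' - (f w + h w) \<le> (1 - \<theta>) * (f x + h x - (f w + h w))
    + \<theta> * (\<gamma> * L / 2 * ((norm (w - z))\<^sup>2 - (norm (w - z'))\<^sup>2)
           + (g - grad y) \<bullet> (w - z') - (\<gamma> - \<theta>) * L / 2 * (norm (z' - z))\<^sup>2)"
proof -
  have xy: "x' - y = \<theta> *\<^sub>R (z' - z)" by (simp add: x' y algebra_simps)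
  have split: "grad y \<bullet> (x' - y) = (1 - \<theta>) * (grad y \<bullet> (x - y)) + \<theta> * (grad y \<bullet> (z' - y))"
  proof -
    have "x' - y = (1 - \<theta>) *\<^sub>R (x - y) + \<theta> *\<^sub>R (z' - y)" by (simp add: x' algebra_simps)
    then show ?thesis by (simp add: inner_simps)
  qed
  have "f x' \<le> f y + grad y \<bullet> (x' - y) + L / 2 * (norm (x' - y))\<^sup>2"
    by (rule lipschitz_gradient_majorant[OF grad lip])
  also have "\<dots> = (1 - \<theta>) * (f y + grad y \<bullet> (x - y)) + \<theta> * (f y + grad y \<bullet> (z' - y))
      + \<theta> * (\<theta> * L / 2 * (norm (z' - z))\<^sup>2)"
    unfolding split unfolding xy norm_scaleR power_mult_distrib power2_abs
    by (simp add: power2_eq_square algebra_simps)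
  also have "(1 - \<theta>) * (f y + grad y \<bullet> (x - y)) \<le> (1 - \<theta>) * f x"
    using convex_gradient_minorant[OF f grad] \<theta> by (intro mult_left_mono) auto
  finally have fx': "f x' \<le> (1 - \<theta>) * f x + \<theta> * (f y + grad y \<bullet> (z' - y) + \<theta> * L / 2 * (norm (z' - z))\<^sup>2)"
    by (simp add: algebra_simps)
  have hx': "h x' \<le> (1 - \<theta>) * h x + \<theta> * h z'"
    unfolding x' using \<theta> by (intro convex_onD[OF h]) auto
  have "f y + grad y \<bullet> (z' - y) + \<theta> * L / 2 * (norm (z' - z))\<^sup>2 + h z'
      \<le> f w + h w + \<gamma> * L / 2 * ((norm (w - z))\<^sup>2 - (norm (w - z'))\<^sup>2)
           + (g - grad y) \<bullet> (w - z') - (\<gamma> - \<theta>) * L / 2 * (norm (z' - z))\<^sup>2" (is "?l \<le> ?r")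
  proof -
    have "f y + grad y \<bullet> (w - y) \<le> f w" by (rule convex_gradient_minorant[OF f grad])
    moreover have "h z' \<le> (w - z') \<bullet> g + \<gamma> * L * ((z' - z) \<bullet> (w - z')) + h w"
      using prox_variational_inequality[OF h z', of w] by simp
    moreover have "(z' - z) \<bullet> (w - z') = ((norm (w - z))\<^sup>2 - (norm (w - z'))\<^sup>2 - (norm (z' - z))\<^sup>2) / 2"
      unfolding power2_norm_eq_inner by (simp add: inner_simps inner_commute algebra_simps)
    ultimately have "h z' \<le> (w - z') \<bullet> g
        + \<gamma> * L * (((norm (w - z))\<^sup>2 - (norm (w - z'))\<^sup>2 - (norm (z' - z))\<^sup>2) / 2) + h w"
      and "f y + grad y \<bullet> (w - y) \<le> f w" by simp_all
    then show ?thesis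
      by (simp add: inner_simps inner_commute algebra_simps diff_divide_distrib add_divide_distrib)
  qed
  then have "\<theta> * ?l \<le> \<theta> * ?r" using \<theta> by (intro mult_left_mono)
  with fx' hx' show ?thesis by (simp add: algebra_simps)
qed

text \<open>The update \<open>z'\<close> depends on the current noise \<open>d\<close>, so \<open>d \<bullet> v\<close> with \<open>v = w - z'\<close> is not centred. It is
  traded for \<open>d \<bullet> u\<close> with \<open>u = w - z\<close>, which is, by completing the square in the leftover
  \<open>(norm (v - u))\<^sup>2\<close>.\<close>

lemma noise_absorption:
  fixes u v d :: "'a::real_inner"
  assumes b: "b > 0"
  shows "k * (d \<bullet> v) - b / 2 * (norm (v - u))\<^sup>2 \<le> k * (d \<bullet> u) + k\<^sup>2 / (2 * b) * (norm d)\<^sup>2"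
proof -
  have "0 \<le> (norm (b *\<^sub>R (v - u) - k *\<^sub>R d))\<^sup>2 / (2 * b)" using b by simp
  then show ?thesis using b unfolding power2_norm_eq_inner
    by (simp add: inner_simps inner_commute power2_eq_square field_simps)
qed

text \<open>In the last iteration the new distance \<open>norm v\<close> need not be passed on, so \<open>- (norm v)\<^sup>2\<close> also helps to
  absorb the noise. The square completed here is that of \<open>(b + c) v - b u - k d\<close>; the cost of the noise
  is half of what it is in \<open>noise_absorption\<close>.\<close>

lemma noise_absorption_last:
  fixes u v d :: "'a::real_inner"
  assumes b: "b > 0" and c: "b \<le> c"
  shows "c / 2 * ((norm u)\<^sup>2 - (norm v)\<^sup>2) + k * (d \<bullet> v) - b / 2 * (norm (v - u))\<^sup>2
    \<le> c / 2 * (norm u)\<^sup>2 + k * b / (b + c) * (d \<bullet> u) + k\<^sup>2 / (4 * b) * (norm d)\<^sup>2"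
proof -
  let ?m = "b + c"
  have m: "?m > 0" using b c by simp
  have "0 \<le> (norm (?m *\<^sub>R v - b *\<^sub>R u - k *\<^sub>R d))\<^sup>2 / (2 * ?m)" using m by simp
  also have "\<dots> = ?m / 2 * (v \<bullet> v) + b\<^sup>2 / (2 * ?m) * (u \<bullet> u) + k\<^sup>2 / (2 * ?m) * (d \<bullet> d)
      - b * (u \<bullet> v) - k * (d \<bullet> v) + k * b / ?m * (d \<bullet> u)"
  proof -
    have "(norm (?m *\<^sub>R v - b *\<^sub>R u - k *\<^sub>R d))\<^sup>2 =
       ?m\<^sup>2 * (v \<bullet> v) + b\<^sup>2 * (u \<bullet> u) + k\<^sup>2 * (d \<bullet> d) - 2 * ?m * b * (u \<bullet> v) - 2 * ?m * k * (d \<bullet> v) + 2 * k * b * (d \<bullet> u)"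
      unfolding power2_norm_eq_inner
      by (simp add: inner_diff_left inner_diff_right inner_commute power2_eq_square algebra_simps)
    then have "(norm (?m *\<^sub>R v - b *\<^sub>R u - k *\<^sub>R d))\<^sup>2 / (2 * ?m) =
       (?m\<^sup>2 / (2 * ?m)) * (v \<bullet> v) + b\<^sup>2 / (2 * ?m) * (u \<bullet> u) + k\<^sup>2 / (2 * ?m) * (d \<bullet> d)
       - (2 * ?m / (2 * ?m)) * (b * (u \<bullet> v)) - (2 * ?m / (2 * ?m)) * (k * (d \<bullet> v)) + 2 * (k * b / (2 * ?m)) * (d \<bullet> u)"
      by (simp only: add_divide_distrib diff_divide_distrib times_divide_eq_left times_divide_eq_right mult.assoc)
    moreover have "?m\<^sup>2 / (2 * ?m) = ?m / 2" "2 * ?m / (2 * ?m) = 1" "2 * (k * b / (2 * ?m)) = k * b / ?m"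
      using m by (auto simp: power2_eq_square field_simps)
    ultimately show ?thesis by (simp only: mult_1_left)
  qed
  also have "b\<^sup>2 / (2 * ?m) * (u \<bullet> u) \<le> b / 2 * (u \<bullet> u)"
    by (rule mult_right_mono) (use b c m in \<open>auto simp: power2_eq_square field_simps\<close>)
  also have "k\<^sup>2 / (2 * ?m) * (d \<bullet> d) \<le> k\<^sup>2 / (4 * b) * (d \<bullet> d)"
    using b c by (intro mult_right_mono divide_left_mono) auto
  finally show ?thesis unfolding power2_norm_eq_inner
    by (simp add: inner_simps inner_commute algebra_simps add_divide_distrib)
qed

section \<open>Noise that is independent of the past\<close>

text \<open>Abstractly, \<open>X\<close> is the past, \<open>Y\<close> a fresh sample, \<open>d\<close> the error of the stochastic gradient at the point
  chosen from \<open>X\<close>, and \<open>u\<close> a vector determined by the past. Independence turns the joint law of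
  \<open>(X, Y)\<close> into a product, and integrating over \<open>Y\<close> first, with \<open>X\<close> frozen, reduces all claims to the
  pointwise hypotheses on \<open>d\<close>.\<close>

lemma (in prob_space) independent_centred_noise:
  fixes d :: "'e \<times> 's \<Rightarrow> 'v::euclidean_space" and u :: "'e \<Rightarrow> 'v"
  assumes X[measurable]: "X \<in> M \<rightarrow>\<^sub>M S" and Y[measurable]: "Y \<in> M \<rightarrow>\<^sub>M P" and law: "distr M P Y = P"
    and joint: "distr M (S \<Otimes>\<^sub>M P) (\<lambda>\<omega>. (X \<omega>, Y \<omega>)) = distr M S X \<Otimes>\<^sub>M P"
    and d[measurable]: "d \<in> borel_measurable (S \<Otimes>\<^sub>M P)"
    and d_int: "\<And>x. integrable P (\<lambda>s. d (x, s))"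
    and mean: "\<And>x. (\<integral>s. d (x, s) \<partial>P) = 0"
    and sq_int: "\<And>x. integrable P (\<lambda>s. (norm (d (x, s)))\<^sup>2)"
    and sq_bound: "\<And>x. (\<integral>s. (norm (d (x, s)))\<^sup>2 \<partial>P) \<le> \<sigma>\<^sup>2"
    and u[measurable]: "u \<in> borel_measurable S"
    and u_sq: "integrable M (\<lambda>\<omega>. (norm (u (X \<omega>)))\<^sup>2)"
  shows "integrable M (\<lambda>\<omega>. (norm (d (X \<omega>, Y \<omega>)))\<^sup>2)"
    and "(\<integral>\<omega>. (norm (d (X \<omega>, Y \<omega>)))\<^sup>2 \<partial>M) \<le> \<sigma>\<^sup>2"
    and "integrable M (\<lambda>\<omega>. d (X \<omega>, Y \<omega>) \<bullet> u (X \<omega>))"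
    and "(\<integral>\<omega>. d (X \<omega>, Y \<omega>) \<bullet> u (X \<omega>) \<partial>M) = 0"
proof -
  interpret Q: prob_space "distr M S X" by (rule prob_space_distr) simp
  interpret P: prob_space P using prob_space_distr[of Y P] law by simp
  interpret QP: pair_prob_space "distr M S X" P ..
  let ?J = "distr M S X \<Otimes>\<^sub>M P"
  have transfer: "integrable M (\<lambda>\<omega>. g (X \<omega>, Y \<omega>)) \<longleftrightarrow> integrable ?J g"
      "(\<integral>\<omega>. g (X \<omega>, Y \<omega>) \<partial>M) = integral\<^sup>L ?J g"
    if [measurable]: "g \<in> borel_measurable (S \<Otimes>\<^sub>M P)" for g :: "'e \<times> 's \<Rightarrow> real"
    unfolding joint[symmetric] by (simp_all add: integrable_distr_eq integral_distr)
  have inner_sq: "(\<lambda>x. \<integral>s. (norm (d (x, s)))\<^sup>2 \<partial>P) \<in> borel_measurable (distr M S X)"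
    by (rule P.borel_measurable_lebesgue_integral) simp
  have inner_sq_int: "integrable (distr M S X) (\<lambda>x. \<integral>s. (norm (d (x, s)))\<^sup>2 \<partial>P)"
    by (rule Q.integrable_const_bound[where B = "\<sigma>\<^sup>2", OF _ inner_sq]) (simp add: sq_bound)
  have d2: "integrable ?J (\<lambda>p. (norm (d p))\<^sup>2)"
    by (rule QP.Fubini_integrable) (use inner_sq_int sq_int in auto)
  then show d2M: "integrable M (\<lambda>\<omega>. (norm (d (X \<omega>, Y \<omega>)))\<^sup>2)"
    using transfer(1)[of "\<lambda>p. (norm (d p))\<^sup>2"] by simp
  have "integral\<^sup>L ?J (\<lambda>p. (norm (d p))\<^sup>2) = (\<integral>x. (\<integral>s. (norm (d (x, s)))\<^sup>2 \<partial>P) \<partial>distr M S X)"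
    by (rule QP.integral_fst'[OF d2, symmetric])
  also have "\<dots> \<le> (\<integral>x. \<sigma>\<^sup>2 \<partial>distr M S X)"
    by (rule integral_mono) (auto intro: inner_sq_int sq_bound)
  finally show "(\<integral>\<omega>. (norm (d (X \<omega>, Y \<omega>)))\<^sup>2 \<partial>M) \<le> \<sigma>\<^sup>2"
    using transfer(2)[of "\<lambda>p. (norm (d p))\<^sup>2"] by (simp add: Q.prob_space[simplified])
  show du: "integrable M (\<lambda>\<omega>. d (X \<omega>, Y \<omega>) \<bullet> u (X \<omega>))"
  proof (rule Bochner_Integration.integrable_bound)
    show "integrable M (\<lambda>\<omega>. (norm (d (X \<omega>, Y \<omega>)))\<^sup>2 + (norm (u (X \<omega>)))\<^sup>2)"
      using d2M u_sq by simp
    have "\<bar>a \<bullet> b\<bar> \<le> (norm a)\<^sup>2 + (norm b)\<^sup>2" for a b :: 'v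
      using Cauchy_Schwarz_ineq2[of a b] sum_squares_bound[of "norm a" "norm b"]
        mult_nonneg_nonneg[of "norm a" "norm b"] by simp
    then show "AE \<omega> in M. norm (d (X \<omega>, Y \<omega>) \<bullet> u (X \<omega>))
        \<le> norm ((norm (d (X \<omega>, Y \<omega>)))\<^sup>2 + (norm (u (X \<omega>)))\<^sup>2)" by simp
  qed measurable
  let ?g = "\<lambda>p. d p \<bullet> u (fst p)"
  have "?g \<in> borel_measurable (S \<Otimes>\<^sub>M P)" by measurable
  note g = transfer[OF this]
  have "integral\<^sup>L ?J ?g = (\<integral>x. (\<integral>s. d (x, s) \<bullet> u x \<partial>P) \<partial>distr M S X)"
    using QP.integral_fst'[of ?g] du g(1) by simp
  also have "\<dots> = 0" using d_int mean by simp
  finally show "(\<integral>\<omega>. d (X \<omega>, Y \<omega>) \<bullet> u (X \<omega>) \<partial>M) = 0" using g(2) by simp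
qed

section \<open>The iterates as random variables\<close>

lemma sg_state_cong:
  "(\<And>i. i < t \<Longrightarrow> s i = s' i) \<Longrightarrow> sg_state N L h G s t = sg_state N L h G s' t"
  by (induction t) (simp_all add: Let_def case_prod_unfold)

lemma sg_gamma_pos: "L > 0 \<Longrightarrow> sg_gamma N L t > 0"
  unfolding sg_gamma_def by (intro mult_pos_pos add_nonneg_pos divide_pos_pos divide_nonneg_pos) auto

lemma sg_state_measurable:
  fixes h :: "real ^ 'n \<Rightarrow> real"
  assumes h: "convex_on UNIV h" and L: "L > 0"
    and G: "(\<lambda>(x, s). G x s) \<in> borel_measurable (borel \<Otimes>\<^sub>M P)"
    and A: "{..<t} \<subseteq> A"
  shows "(\<lambda>s. sg_state N L h G s t) \<in> borel_measurable (PiM A (\<lambda>_. P))"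
  using A
proof (induction t)
  case (Suc t)
  let ?B = "borel_measurable (PiM A (\<lambda>_. P))"
  define x where "x s = fst (sg_state N L h G s t)" for s
  define z where "z s = snd (sg_state N L h G s t)" for s
  define y where "y s = (1 - sg_theta t) *\<^sub>R x s + sg_theta t *\<^sub>R z s" for s
  have t: "t \<in> A" and st: "(\<lambda>s. sg_state N L h G s t) \<in> ?B"
    using Suc by (auto simp: lessThan_Suc)
  have xz[measurable]: "x \<in> ?B" "z \<in> ?B"
    unfolding x_def z_def
    by (rule measurable_compose[OF st], intro borel_measurable_continuous_onI continuous_intros)+
  have y: "y \<in> ?B" unfolding y_def by measurable
  have "(\<lambda>s. (y s, s t)) \<in> PiM A (\<lambda>_. P) \<rightarrow>\<^sub>M borel \<Otimes>\<^sub>M P"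
    using y measurable_component_singleton[OF t] by (intro measurable_Pair) auto
  from measurable_compose[OF this G] have Gy: "(\<lambda>s. G (y s) (s t)) \<in> ?B" by simp
  let ?z' = "\<lambda>s. sg_prox (sg_gamma N L t) L h (G (y s) (s t)) (z s)"
  have z': "?z' \<in> ?B"
    using borel_measurable_continuous_Pair[OF Gy xz(2)
        continuous_on_sg_prox[OF h mult_pos_pos[OF sg_gamma_pos[OF L] L]]] by simp
  have "(\<lambda>s. ((1 - sg_theta t) *\<^sub>R x s + sg_theta t *\<^sub>R ?z' s, ?z' s)) \<in> ?B"
    using z' by (intro borel_measurable_Pair) auto
  moreover have "(\<lambda>s. sg_state N L h G s (Suc t)) = (\<lambda>s. ((1 - sg_theta t) *\<^sub>R x s + sg_theta t *\<^sub>R ?z' s, ?z' s))"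
    by (simp add: x_def z_def y_def Let_def case_prod_unfold fun_eq_iff)
  ultimately show ?case by simp
qed simp

text \<open>The state at time \<open>t\<close> is a function of the samples before \<open>t\<close> and hence independent of the sample at
  time \<open>t\<close>. Independence enters through the restrictions of the sample sequence to \<open>{..<t}\<close> and to \<open>{t}\<close>;
  their product law is then pushed forward along the two functions.\<close>

lemma (in prob_space) sg_state_joint_law:
  fixes h :: "real ^ 'n \<Rightarrow> real"
  assumes h: "convex_on UNIV h" and L: "L > 0"
    and G: "(\<lambda>(x, s). G x s) \<in> borel_measurable (borel \<Otimes>\<^sub>M P)"
    and indep: "indep_vars (\<lambda>_. P) \<xi> {0..N}" and t: "t \<le> N" and law: "distr M P (\<xi> t) = P"
  defines "X \<equiv> \<lambda>\<omega>. sg_state N L h G (\<lambda>i. \<xi> i \<omega>) t"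
  shows "distr M (borel \<Otimes>\<^sub>M P) (\<lambda>\<omega>. (X \<omega>, \<xi> t \<omega>)) = distr M borel X \<Otimes>\<^sub>M P"
proof -
  let ?A = "PiM {..<t} (\<lambda>_. P)" and ?B = "PiM {t} (\<lambda>_. P)"
  let ?a = "\<lambda>\<omega>. restrict (\<lambda>i. \<xi> i \<omega>) {..<t}" and ?b = "\<lambda>\<omega>. restrict (\<lambda>i. \<xi> i \<omega>) {t}"
  let ?f = "\<lambda>s. sg_state N L h G s t" and ?g = "\<lambda>s. s t"
  have f: "?f \<in> ?A \<rightarrow>\<^sub>M borel" by (rule sg_state_measurable[OF h L G order_refl])
  have g: "?g \<in> ?B \<rightarrow>\<^sub>M P" by (rule measurable_component_singleton) simp
  have "indep_var ?A ?a ?B ?b"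
    using t by (intro indep_var_restrict[OF indep]) auto
  then have a: "?a \<in> M \<rightarrow>\<^sub>M ?A" and b: "?b \<in> M \<rightarrow>\<^sub>M ?B"
    and ab: "distr M (?A \<Otimes>\<^sub>M ?B) (\<lambda>\<omega>. (?a \<omega>, ?b \<omega>)) = distr M ?A ?a \<Otimes>\<^sub>M distr M ?B ?b"
    unfolding indep_var_distribution_eq by auto
  have X: "X = (\<lambda>\<omega>. ?f (?a \<omega>))"
    unfolding X_def by (auto simp: fun_eq_iff intro!: sg_state_cong)
  have da: "distr (distr M ?A ?a) borel ?f = distr M borel X"
    unfolding X by (subst distr_distr[OF f a]) (simp add: comp_def)
  have db: "distr (distr M ?B ?b) P ?g = P"
    by (subst distr_distr[OF g b]) (simp add: comp_def law)
  interpret P: prob_space P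
    using prob_space.prob_space_distr[OF prob_space_distr[OF b], of ?g P] g unfolding db by simp
  have "distr M (borel \<Otimes>\<^sub>M P) (\<lambda>\<omega>. (X \<omega>, \<xi> t \<omega>))
      = distr (distr M (?A \<Otimes>\<^sub>M ?B) (\<lambda>\<omega>. (?a \<omega>, ?b \<omega>))) (borel \<Otimes>\<^sub>M P) (\<lambda>(p, q). (?f p, ?g q))"
  proof (subst distr_distr)
    show "(\<lambda>(p, q). (?f p, ?g q)) \<in> ?A \<Otimes>\<^sub>M ?B \<rightarrow>\<^sub>M borel \<Otimes>\<^sub>M P"
      using f g by measurable
    show "(\<lambda>\<omega>. (?a \<omega>, ?b \<omega>)) \<in> M \<rightarrow>\<^sub>M ?A \<Otimes>\<^sub>M ?B"
      using a b by (rule measurable_Pair)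
  qed (simp add: X comp_def)
  also have "\<dots> = distr M borel X \<Otimes>\<^sub>M P"
    unfolding ab using pair_measure_distr[of ?f "distr M ?A ?a" borel ?g "distr M ?B ?b" P] f g
    unfolding da db by (simp add: P.sigma_finite_measure_axioms)
  finally show ?thesis .
qed

lemma (in prob_space) sg_state_random_variable:
  fixes h :: "real ^ 'n \<Rightarrow> real"
  assumes h: "convex_on UNIV h" and L: "L > 0"
    and G: "(\<lambda>(x, s). G x s) \<in> borel_measurable (borel \<Otimes>\<^sub>M P)"
    and \<xi>: "\<And>i. i < t \<Longrightarrow> random_variable P (\<xi> i)"
  shows "random_variable borel (\<lambda>\<omega>. sg_state N L h G (\<lambda>i. \<xi> i \<omega>) t)"
proof -
  have "(\<lambda>\<omega>. restrict (\<lambda>i. \<xi> i \<omega>) {..<t}) \<in> M \<rightarrow>\<^sub>M PiM {..<t} (\<lambda>_. P)"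
    using \<xi> by (intro measurable_restrict) auto
  from measurable_compose[OF this sg_state_measurable[OF h L G order_refl]]
  have "random_variable borel (\<lambda>\<omega>. sg_state N L h G (restrict (\<lambda>i. \<xi> i \<omega>) {..<t}) t)" .
  moreover have "sg_state N L h G (restrict (\<lambda>i. \<xi> i \<omega>) {..<t}) t = sg_state N L h G (\<lambda>i. \<xi> i \<omega>) t" for \<omega>
    by (rule sg_state_cong) simp
  ultimately show ?thesis by simp
qed

section \<open>Expected decrease of a potential\<close>

locale sg_run = prob_space M
  for M :: "'w measure" +
  fixes f h :: "real ^ 'n \<Rightarrow> real"
    and grad :: "real ^ 'n \<Rightarrow> real ^ 'n"
    and G :: "real ^ 'n \<Rightarrow> 's \<Rightarrow> real ^ 'n"
    and P :: "'s measure"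
    and \<xi> :: "nat \<Rightarrow> 'w \<Rightarrow> 's"
    and L \<sigma> :: real
    and N :: nat
    and w :: "real ^ 'n"
  assumes f_convex: "convex_on UNIV f"
    and f_grad: "\<And>x. GDERIV f x :> grad x"
    and L_pos: "L > 0"
    and lip: "L-lipschitz_on UNIV grad"
    and h_convex: "convex_on UNIV h"
    and G_measurable: "(\<lambda>(x, s). G x s) \<in> borel_measurable (borel \<Otimes>\<^sub>M P)"
    and G_integrable: "\<And>x. integrable P (G x)"
    and G_unbiased: "\<And>x. (\<integral>s. G x s \<partial>P) = grad x"
    and G_sq_integrable: "\<And>x. integrable P (\<lambda>s. (norm (grad x - G x s))\<^sup>2)"
    and G_variance: "\<And>x. (\<integral>s. (norm (grad x - G x s))\<^sup>2 \<partial>P) \<le> \<sigma>\<^sup>2"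
    and w_min: "\<And>x. f w + h w \<le> f x + h x"
    and N_pos: "N \<ge> 1"
    and xi_indep: "indep_vars (\<lambda>_. P) \<xi> {0..N}"
    and xi_law: "\<And>t. t \<le> N \<Longrightarrow> distr M P (\<xi> t) = P"
begin

definition state where "state t \<omega> = sg_state N L h G (\<lambda>i. \<xi> i \<omega>) t"
definition query where "query t q = (1 - sg_theta t) *\<^sub>R fst q + sg_theta t *\<^sub>R snd q" for q :: "(real ^ 'n) \<times> (real ^ 'n)"
definition gap where "gap t \<omega> = f (fst (state t \<omega>)) + h (fst (state t \<omega>)) - (f w + h w)"
definition err where "err t \<omega> = w - snd (state t \<omega>)"
definition noise where
  "noise t \<omega> = G (query t (state t \<omega>)) (\<xi> t \<omega>) - grad (query t (state t \<omega>))"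

text \<open>With \<open>k = (t + 2) / 2 = 1 / \<theta>\<^sub>t\<close>, these are the constants \<open>b\<close> and \<open>c\<close> of the
  introduction: \<open>k * ((\<gamma>\<^sub>t - \<theta>\<^sub>t) * L)\<close> and \<open>k * (\<gamma>\<^sub>t * L)\<close>. The step sizes
  are chosen so that both are independent of \<open>t\<close>, which lets the distance terms telescope.\<close>

definition slack_weight where "slack_weight = real N powr (3/2) + L"
definition step_weight where "step_weight = real N powr (3/2) + 2 * L"

lemma slack_weight_pos: "slack_weight > 0"
  and slack_le_step: "slack_weight \<le> step_weight"
  and step_weight_pos: "step_weight > 0"
proof -
  show "slack_weight > 0" using L_pos by (simp add: slack_weight_def add_nonneg_pos)
  moreover show "slack_weight \<le> step_weight" using L_pos by (simp add: slack_weight_def step_weight_def)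
  ultimately show "step_weight > 0" by linarith
qed

lemma gap_nonneg: "gap t \<omega> \<ge> 0"
  using w_min by (simp add: gap_def)

text \<open>The one-step bound divided by \<open>\<theta>\<^sub>t\<^sup>2\<close>, which gives the distances to \<open>w\<close> the constant weight
  \<open>step_weight / 2\<close>.\<close>

lemma one_step:
  fixes t :: nat
  defines "k \<equiv> (real t + 2) / 2"
  shows "k\<^sup>2 * gap (Suc t) \<omega> \<le> real t * (real t + 2) / 4 * gap t \<omega>
    + step_weight / 2 * ((norm (err t \<omega>))\<^sup>2 - (norm (err (Suc t) \<omega>))\<^sup>2)
    + k * (noise t \<omega> \<bullet> err (Suc t) \<omega>) - slack_weight / 2 * (norm (err (Suc t) \<omega> - err t \<omega>))\<^sup>2"
proof -
  let ?\<theta> = "sg_theta t" and ?\<gamma> = "sg_gamma N L t"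
  let ?x = "fst (state t \<omega>)" and ?z = "snd (state t \<omega>)" and ?y = "query t (state t \<omega>)"
  let ?x' = "fst (state (Suc t) \<omega>)" and ?z' = "snd (state (Suc t) \<omega>)"
  have k: "k > 0" and \<theta>: "?\<theta> = 1 / k" by (auto simp: k_def sg_theta_def)
  have \<gamma>: "?\<gamma> * L = step_weight / k" "(?\<gamma> - ?\<theta>) * L = slack_weight / k"
  proof -
    have "?\<gamma> * L = 1 / k * ((real N powr (3/2) / L + 2) * L)" by (simp add: k_def sg_gamma_def)
    also have "(real N powr (3/2) / L + 2) * L = step_weight" using L_pos by (simp add: step_weight_def distrib_right)
    finally show "?\<gamma> * L = step_weight / k" by simp
    then show "(?\<gamma> - ?\<theta>) * L = slack_weight / k"
      by (simp add: left_diff_distrib \<theta> slack_weight_def step_weight_def flip: diff_divide_distrib)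
  qed
  have z': "?z' = sg_prox ?\<gamma> L h (G ?y (\<xi> t \<omega>)) ?z"
    by (simp add: state_def query_def Let_def case_prod_unfold)
  have x': "?x' = (1 - ?\<theta>) *\<^sub>R ?x + ?\<theta> *\<^sub>R ?z'"
    by (simp add: state_def query_def Let_def case_prod_unfold)
  have min: "is_arg_min (\<lambda>x. x \<bullet> G ?y (\<xi> t \<omega>) + ?\<gamma> * L / 2 * (norm (x - ?z))\<^sup>2 + h x) (\<lambda>_. True) ?z'"
    unfolding z' by (rule sg_prox_is_arg_min[OF h_convex mult_pos_pos[OF sg_gamma_pos[OF L_pos] L_pos]])
  have "gap (Suc t) \<omega> \<le> (1 - ?\<theta>) * gap t \<omega>
    + ?\<theta> * (?\<gamma> * L / 2 * ((norm (err t \<omega>))\<^sup>2 - (norm (err (Suc t) \<omega>))\<^sup>2)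
           + noise t \<omega> \<bullet> err (Suc t) \<omega> - (?\<gamma> - ?\<theta>) * L / 2 * (norm (?z' - ?z))\<^sup>2)"
    unfolding gap_def err_def noise_def
    by (rule sg_one_step[OF f_convex f_grad lip h_convex _ _ _ x' min])
       (auto simp: query_def sg_theta_def)
  also have "norm (?z' - ?z) = norm (err (Suc t) \<omega> - err t \<omega>)"
    by (simp add: err_def norm_minus_commute)
  finally have "gap (Suc t) \<omega> \<le> (1 - 1 / k) * gap t \<omega>
    + 1 / k * (step_weight / k / 2 * ((norm (err t \<omega>))\<^sup>2 - (norm (err (Suc t) \<omega>))\<^sup>2)
           + noise t \<omega> \<bullet> err (Suc t) \<omega> - slack_weight / k / 2 * (norm (err (Suc t) \<omega> - err t \<omega>))\<^sup>2)"
    unfolding \<gamma> unfolding \<theta> .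
  moreover have "k\<^sup>2 * ((1 - 1 / k) * a + 1 / k * (step_weight / k / 2 * p + n - slack_weight / k / 2 * q))
      = (k\<^sup>2 - k) * a + (step_weight / 2 * p + k * n - slack_weight / 2 * q)" for a p n q
    using k by (simp add: power2_eq_square field_simps)
  moreover note mult_left_mono[OF calculation(1), of "k\<^sup>2"]
  ultimately
  have "k\<^sup>2 * gap (Suc t) \<omega> \<le> (k\<^sup>2 - k) * gap t \<omega>
    + (step_weight / 2 * ((norm (err t \<omega>))\<^sup>2 - (norm (err (Suc t) \<omega>))\<^sup>2)
    + k * (noise t \<omega> \<bullet> err (Suc t) \<omega>) - slack_weight / 2 * (norm (err (Suc t) \<omega> - err t \<omega>))\<^sup>2)"
    by simp
  moreover have "k\<^sup>2 - k = real t * (real t + 2) / 4"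
    by (simp add: k_def power2_eq_square field_simps)
  ultimately show ?thesis by (simp only: add_diff_eq add.assoc)
qed

lemma xi_random: "t \<le> N \<Longrightarrow> random_variable P (\<xi> t)"
  using xi_indep by (auto simp: indep_vars_def)

lemma state_random: "t \<le> Suc N \<Longrightarrow> random_variable borel (state t)"
  unfolding state_def
  by (rule sg_state_random_variable[OF h_convex L_pos G_measurable]) (auto intro: xi_random)

lemma gap_random: "t \<le> Suc N \<Longrightarrow> random_variable borel (gap t)"
proof -
  assume "t \<le> Suc N"
  from state_random[OF this] have x: "random_variable borel (\<lambda>\<omega>. fst (state t \<omega>))"
    by (rule measurable_compose) (intro borel_measurable_continuous_onI continuous_intros)
  have "(\<lambda>x. f x + h x - (f w + h w)) \<in> borel_measurable borel"
    using convex_on_continuous[OF open_UNIV f_convex] convex_on_continuous[OF open_UNIV h_convex]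
    by (intro borel_measurable_continuous_onI continuous_intros)
  from measurable_compose[OF x this] show ?thesis by (simp add: gap_def[abs_def])
qed

lemma err_random: "t \<le> Suc N \<Longrightarrow> random_variable borel (err t)"
  unfolding err_def[abs_def]
  by (rule measurable_compose[OF state_random])
     (auto intro!: borel_measurable_continuous_onI continuous_intros)

lemma noise_moments:
  assumes t: "t \<le> N" and sq: "integrable M (\<lambda>\<omega>. (norm (err t \<omega>))\<^sup>2)"
  shows "integrable M (\<lambda>\<omega>. (norm (noise t \<omega>))\<^sup>2)"
    and "(\<integral>\<omega>. (norm (noise t \<omega>))\<^sup>2 \<partial>M) \<le> \<sigma>\<^sup>2"
    and "integrable M (\<lambda>\<omega>. noise t \<omega> \<bullet> err t \<omega>)"
    and "(\<integral>\<omega>. noise t \<omega> \<bullet> err t \<omega> \<partial>M) = 0"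
proof -
  define d where "d p = G (query t (fst p)) (snd p) - grad (query t (fst p))"
    for p :: "((real ^ 'n) \<times> (real ^ 'n)) \<times> 's"
  have joint: "distr M (borel \<Otimes>\<^sub>M P) (\<lambda>\<omega>. (state t \<omega>, \<xi> t \<omega>)) = distr M borel (state t) \<Otimes>\<^sub>M P"
    unfolding state_def
    by (rule sg_state_joint_law[OF h_convex L_pos G_measurable xi_indep t xi_law[OF t]])
  interpret P: prob_space P
    using prob_space_distr[OF xi_random[OF t]] xi_law[OF t] by simp
  have q[measurable]: "query t \<in> borel \<rightarrow>\<^sub>M borel"
    unfolding query_def[abs_def] by (intro borel_measurable_continuous_onI continuous_intros)
  have gq[measurable]: "grad \<in> borel \<rightarrow>\<^sub>M borel"
    by (rule borel_measurable_continuous_onI, rule lipschitz_on_continuous_on[OF lip])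
  have "(\<lambda>p. (query t (fst p), snd p)) \<in> borel \<Otimes>\<^sub>M P \<rightarrow>\<^sub>M borel \<Otimes>\<^sub>M P" by measurable
  from measurable_compose[OF this G_measurable]
  have d: "d \<in> borel_measurable (borel \<Otimes>\<^sub>M P)" unfolding d_def[abs_def] by simp
  have u: "(\<lambda>q. w - snd q) \<in> borel_measurable (borel :: ((real ^ 'n) \<times> (real ^ 'n)) measure)"
    by (intro borel_measurable_continuous_onI continuous_intros)
  note * = independent_centred_noise[of "state t" borel "\<xi> t" P d \<sigma> "\<lambda>q. w - snd q"]
  have prems: "random_variable borel (state t)" "random_variable P (\<xi> t)"
    "\<And>x. integrable P (\<lambda>s. d (x, s))" "\<And>x. (\<integral>s. d (x, s) \<partial>P) = 0"
    "\<And>x. integrable P (\<lambda>s. (norm (d (x, s)))\<^sup>2)" "\<And>x. (\<integral>s. (norm (d (x, s)))\<^sup>2 \<partial>P) \<le> \<sigma>\<^sup>2"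
    using t G_integrable G_unbiased G_sq_integrable G_variance state_random xi_random
    by (auto simp: d_def P.prob_space norm_minus_commute)
  note * = *[OF prems(1,2) xi_law[OF t] joint d prems(3-6) u sq[unfolded err_def]]
  show "integrable M (\<lambda>\<omega>. (norm (noise t \<omega>))\<^sup>2)"
    and "(\<integral>\<omega>. (norm (noise t \<omega>))\<^sup>2 \<partial>M) \<le> \<sigma>\<^sup>2"
    and "integrable M (\<lambda>\<omega>. noise t \<omega> \<bullet> err t \<omega>)"
    and "(\<integral>\<omega>. noise t \<omega> \<bullet> err t \<omega> \<partial>M) = 0"
    using * by (simp_all add: d_def noise_def err_def)
qed

text \<open>The weight of the gap is \<open>(1 - \<theta>\<^sub>t) / \<theta>\<^sub>t\<^sup>2\<close>, the one with which it enters the bound for the next step.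
  It vanishes at \<open>t = 0\<close>, so the initial gap does not appear in the rate.\<close>

definition potential where
  "potential t \<omega> = real t * (real t + 2) / 4 * gap t \<omega> + step_weight / 2 * (norm (err t \<omega>))\<^sup>2"

lemma potential_nonneg: "potential t \<omega> \<ge> 0"
  unfolding potential_def using gap_nonneg step_weight_pos by (intro add_nonneg_nonneg mult_nonneg_nonneg) auto

lemma potential_random: "t \<le> Suc N \<Longrightarrow> random_variable borel (potential t)"
  unfolding potential_def[abs_def] using gap_random[of t] err_random[of t] by measurable

text \<open>Integrability is carried along by the same induction as the bound: a finite expected potential gives the
  square integrability of \<open>err t\<close> that the noise estimates at time \<open>t\<close> require.\<close>

lemma err_sq_integrable:
  assumes t: "t \<le> Suc N" and int: "integrable M (potential t)"
  shows "integrable M (\<lambda>\<omega>. (norm (err t \<omega>))\<^sup>2)"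
proof (rule Bochner_Integration.integrable_bound)
  show "integrable M (\<lambda>\<omega>. 2 / step_weight * potential t \<omega>)" using int by simp
  show "(\<lambda>\<omega>. (norm (err t \<omega>))\<^sup>2) \<in> borel_measurable M" using err_random[OF t] by measurable
  have "(norm (err t \<omega>))\<^sup>2 \<le> 2 / step_weight * potential t \<omega>" for \<omega>
    using step_weight_pos gap_nonneg[of t \<omega>] by (simp add: potential_def field_simps)
  then have "norm ((norm (err t \<omega>))\<^sup>2) \<le> norm (2 / step_weight * potential t \<omega>)" for \<omega>
    using potential_nonneg[of t \<omega>] step_weight_pos by simp
  then show "AE \<omega> in M. norm ((norm (err t \<omega>))\<^sup>2) \<le> norm (2 / step_weight * potential t \<omega>)"
    by (rule AE_I2)
qed

lemma potential_step:
  "potential (Suc t) \<omega> \<le> potential t \<omega> + (real t + 2) / 2 * (noise t \<omega> \<bullet> err t \<omega>)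
    + (real t + 2)\<^sup>2 / (8 * slack_weight) * (norm (noise t \<omega>))\<^sup>2"
proof -
  let ?k = "(real t + 2) / 2"
  \<comment> \<open>\<open>(t + 1) (t + 3) \<le> (t + 2)\<^sup>2\<close>: the weight gained in one step covers the weight needed in the next.\<close>
  have "real (Suc t) * (real (Suc t) + 2) / 4 * gap (Suc t) \<omega> \<le> ?k\<^sup>2 * gap (Suc t) \<omega>"
    by (intro mult_right_mono gap_nonneg) (simp add: power2_eq_square field_simps)
  moreover have k: "?k\<^sup>2 / (2 * slack_weight) = (real t + 2)\<^sup>2 / (8 * slack_weight)" by (simp add: power_divide)
  note noise_absorption[OF slack_weight_pos, of ?k "noise t \<omega>" "err (Suc t) \<omega>" "err t \<omega>", unfolded k]
  ultimately show ?thesis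
    using one_step[of t \<omega>] unfolding potential_def right_diff_distrib by linarith
qed

lemma expected_potential:
  assumes "t \<le> Suc N"
  shows "integrable M (potential t) \<and>
    expectation (potential t) \<le> step_weight / 2 * (norm w)\<^sup>2 + \<sigma>\<^sup>2 / (8 * slack_weight) * (\<Sum>i<t. (real i + 2)\<^sup>2)"
  using assms
proof (induction t)
  case 0
  have "potential 0 = (\<lambda>_. step_weight / 2 * (norm w)\<^sup>2)"
    by (simp add: fun_eq_iff potential_def err_def state_def)
  then show ?case by (simp add: prob_space)
next
  case (Suc t)
  then have t: "t \<le> N" and IH: "integrable M (potential t)"
    "expectation (potential t) \<le> step_weight / 2 * (norm w)\<^sup>2 + \<sigma>\<^sup>2 / (8 * slack_weight) * (\<Sum>i<t. (real i + 2)\<^sup>2)" by auto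
  note nm = noise_moments[OF t err_sq_integrable[OF _ IH(1)]]
  let ?U = "\<lambda>\<omega>. potential t \<omega> + (real t + 2) / 2 * (noise t \<omega> \<bullet> err t \<omega>)
      + (real t + 2)\<^sup>2 / (8 * slack_weight) * (norm (noise t \<omega>))\<^sup>2"
  have U: "integrable M ?U" using IH nm t by simp
  have int: "integrable M (potential (Suc t))"
  proof (rule Bochner_Integration.integrable_bound[OF U])
    show "AE \<omega> in M. norm (potential (Suc t) \<omega>) \<le> norm (?U \<omega>)"
      using potential_step potential_nonneg by (auto intro: order_trans[OF _ abs_ge_self])
  qed (use potential_random Suc in auto)
  have "expectation (potential (Suc t)) \<le> expectation ?U"
    by (rule integral_mono[OF int U potential_step])
  also have "\<dots> = expectation (potential t)
      + (real t + 2)\<^sup>2 / (8 * slack_weight) * expectation (\<lambda>\<omega>. (norm (noise t \<omega>))\<^sup>2)"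
    using IH(1) nm t by simp
  also have "(real t + 2)\<^sup>2 / (8 * slack_weight) * expectation (\<lambda>\<omega>. (norm (noise t \<omega>))\<^sup>2)
      \<le> (real t + 2)\<^sup>2 / (8 * slack_weight) * \<sigma>\<^sup>2"
    using nm(2) t slack_weight_pos by (intro mult_left_mono) auto
  finally show ?case using int IH(2) by (simp add: algebra_simps)
qed

lemma gap_integrable: "integrable M (gap (Suc N))"
proof (rule Bochner_Integration.integrable_bound)
  show "integrable M (potential (Suc N))" using expected_potential by simp
  show "random_variable borel (gap (Suc N))" by (rule gap_random) simp
  have "gap (Suc N) \<omega> \<le> potential (Suc N) \<omega>" for \<omega>
  proof -
    have "1 \<le> real (Suc N) * (real (Suc N) + 2) / 4"
      using N_pos mult_mono[of 2 "real (Suc N)" 2 "real (Suc N) + 2"] by simp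
    from mult_right_mono[OF this gap_nonneg]
    have "gap (Suc N) \<omega> \<le> real (Suc N) * (real (Suc N) + 2) / 4 * gap (Suc N) \<omega>" by simp
    then show ?thesis using step_weight_pos by (simp add: potential_def add_increasing2)
  qed
  then show "AE \<omega> in M. norm (gap (Suc N) \<omega>) \<le> norm (potential (Suc N) \<omega>)"
    using gap_nonneg by (auto intro: order_trans[OF _ abs_ge_self])
qed

lemma expected_gap:
  "(real N + 2)\<^sup>2 / 4 * expectation (gap (Suc N)) \<le> step_weight / 2 * (norm w)\<^sup>2
    + \<sigma>\<^sup>2 / slack_weight * ((\<Sum>i<N. (real i + 2)\<^sup>2) / 8 + (real N + 2)\<^sup>2 / 16)"
proof -
  let ?k = "(real N + 2) / 2"
  have pot: "integrable M (potential N)"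
    "expectation (potential N) \<le> step_weight / 2 * (norm w)\<^sup>2 + \<sigma>\<^sup>2 / (8 * slack_weight) * (\<Sum>i<N. (real i + 2)\<^sup>2)"
    using expected_potential[of N] by auto
  note nm = noise_moments[OF order_refl err_sq_integrable[OF _ pot(1)]]
  let ?U = "\<lambda>\<omega>. potential N \<omega> + ?k * slack_weight / (slack_weight + step_weight) * (noise N \<omega> \<bullet> err N \<omega>)
      + ?k\<^sup>2 / (4 * slack_weight) * (norm (noise N \<omega>))\<^sup>2"
  have U: "integrable M ?U" using pot nm by simp
  have "?k\<^sup>2 * gap (Suc N) \<omega> \<le> ?U \<omega>" for \<omega>
    using one_step[of N \<omega>]
      noise_absorption_last[OF slack_weight_pos slack_le_step, of "err N \<omega>" "err (Suc N) \<omega>" ?k "noise N \<omega>"]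
    by (simp add: potential_def)
  then have "expectation (\<lambda>\<omega>. ?k\<^sup>2 * gap (Suc N) \<omega>) \<le> expectation ?U"
    using gap_integrable U by (intro integral_mono) auto
  also have "\<dots> = expectation (potential N) + ?k\<^sup>2 / (4 * slack_weight) * expectation (\<lambda>\<omega>. (norm (noise N \<omega>))\<^sup>2)"
    using pot(1) nm by simp
  also have "\<dots> \<le> step_weight / 2 * (norm w)\<^sup>2 + \<sigma>\<^sup>2 / (8 * slack_weight) * (\<Sum>i<N. (real i + 2)\<^sup>2) + ?k\<^sup>2 / (4 * slack_weight) * \<sigma>\<^sup>2"
    using pot nm(2) slack_weight_pos by (intro add_mono mult_left_mono) auto
  also have "\<dots> = step_weight / 2 * (norm w)\<^sup>2
    + \<sigma>\<^sup>2 / slack_weight * ((\<Sum>i<N. (real i + 2)\<^sup>2) / 8 + (real N + 2)\<^sup>2 / 16)"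
    using slack_weight_pos by (simp add: power_divide field_simps)
  finally show ?thesis by (simp add: power_divide)
qed

end

section \<open>The rate\<close>

lemma sum_shifted_squares: "(\<Sum>i<N. (real i + 2)\<^sup>2) \<le> (real N + 1) * (real N + 2) * (2 * real N + 3) / 6"
  by (induction N) (simp_all add: power2_eq_square field_simps)

text \<open>This is where the saving in the last iteration matters. With the full noise cost the term
  \<open>(N + 2)\<^sup>2 / 4\<close> would be \<open>(N + 2)\<^sup>2 / 2\<close>, and for \<open>N = 1\<close> the left-hand side \<open>4 / 2 + 9 / 2\<close> would exceed the
  right-hand side \<open>3 * sqrt 3\<close>.\<close>

lemma rate_arithmetic:
  assumes N: "N \<ge> 1"
  shows "(\<Sum>i<N. (real i + 2)\<^sup>2) / 2 + (real N + 2)\<^sup>2 / 4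
    \<le> real N powr (3/2) * (real N + 2)\<^sup>2 / (real N + 2) powr (1/2)"
proof -
  let ?n = "real N"
  have n: "?n \<ge> 1" using N by simp
  have powr: "?n powr (3/2) = ?n * sqrt ?n"
    using powr_add[of ?n 1 "1/2"] n by (simp add: powr_half_sqrt)
  \<comment> \<open>Any constant between about \<open>0.6\<close> and \<open>sqrt 3 - 1\<close> in place of \<open>7/10\<close> suffices; \<open>N = 1\<close> is the
    tight case on both sides.\<close>
  have "sqrt (?n * (?n + 2)) \<ge> ?n + 7/10"
    using n by (intro real_le_rsqrt) (simp add: power2_eq_square algebra_simps)
  then have s: "sqrt ?n * sqrt (?n + 2) \<ge> ?n + 7/10" by (simp add: real_sqrt_mult)
  have "(\<Sum>i<N. (real i + 2)\<^sup>2) / 2 + (?n + 2)\<^sup>2 / 4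
      \<le> (?n + 1) * (?n + 2) * (2 * ?n + 3) / 12 + (?n + 2)\<^sup>2 / 4"
    using sum_shifted_squares[of N] by simp
  also have "\<dots> = (?n + 2) * ((2 * ?n\<^sup>2 + 8 * ?n + 9) / 12)"
    by (simp add: power2_eq_square field_simps)
  also have "\<dots> \<le> (?n + 2) * (?n * (?n + 7/10))"
  proof (rule mult_left_mono)
    have "?n * ?n \<ge> 1 * 1" using n by (intro mult_mono) auto
    then show "(2 * ?n\<^sup>2 + 8 * ?n + 9) / 12 \<le> ?n * (?n + 7/10)"
      using n by (simp add: power2_eq_square field_simps)
  qed simp
  also have "\<dots> \<le> (?n + 2) * (?n * (sqrt ?n * sqrt (?n + 2)))"
    using s by (intro mult_left_mono) auto
  also have "\<dots> = ?n powr (3/2) * (?n + 2)\<^sup>2 / (?n + 2) powr (1/2)"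
  proof -
    have "(?n + 2)\<^sup>2 / sqrt (?n + 2) = (?n + 2) * sqrt (?n + 2)"
      using real_sqrt_mult_self[of "?n + 2"] by (simp add: power2_eq_square field_simps)
    then show ?thesis
      unfolding powr by (simp add: powr_half_sqrt flip: times_divide_eq_right)
  qed
  finally show ?thesis .
qed

lemma initial_distance_rate:
  assumes N: "N \<ge> 1"
  shows "real N powr (3/2) \<le> (real N + 2)\<^sup>2 / (real N + 2) powr (1/2)"
proof -
  have "real N powr (3/2) \<le> (real N + 2) powr (3/2)" by (intro powr_mono2) auto
  also have "\<dots> = (real N + 2) powr 2 / (real N + 2) powr (1/2)"
    by (subst powr_diff[symmetric]) simp
  finally show ?thesis by simp
qed

lemma rate_from_expected_gap:
  assumes N: "N \<ge> 1" and L: "L > 0"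
    and gap: "(real N + 2)\<^sup>2 / 4 * e \<le> (real N powr (3/2) + 2 * L) / 2 * D\<^sup>2
      + \<sigma>\<^sup>2 / (real N powr (3/2) + L) * ((\<Sum>i<N. (real i + 2)\<^sup>2) / 8 + (real N + 2)\<^sup>2 / 16)"
  shows "e \<le> (2 * D\<^sup>2 + \<sigma>\<^sup>2) / (real N + 2) powr (1/2) + L * ((4 * D\<^sup>2 + 2 * \<sigma>\<^sup>2) / (real N + 2)\<^sup>2)"
proof -
  let ?p = "real N powr (3/2)" and ?m = "(real N + 2)\<^sup>2" and ?r = "(real N + 2) powr (1/2)"
  let ?S = "(\<Sum>i<N. (real i + 2)\<^sup>2) / 2 + ?m / 4"
  have p: "?p > 0" using N by simp
  have S0: "?S \<ge> 0" by (intro add_nonneg_nonneg divide_nonneg_nonneg sum_nonneg) auto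
  have "?S / (?p + L) \<le> ?S / ?p"
    by (intro divide_left_mono mult_pos_pos add_pos_pos p L S0) (use L in simp)
  also have "\<dots> \<le> ?m / ?r"
    using rate_arithmetic[OF N] p by (simp add: field_simps)
  finally have S: "\<sigma>\<^sup>2 * (?S / (?p + L)) \<le> \<sigma>\<^sup>2 * (?m / ?r)" by (intro mult_left_mono) auto
  have D: "?p * D\<^sup>2 \<le> ?m / ?r * D\<^sup>2" using initial_distance_rate[OF N] by (rule mult_right_mono) simp
  have "?m * e \<le> 2 * (?p * D\<^sup>2) + 4 * L * D\<^sup>2 + \<sigma>\<^sup>2 * (?S / (?p + L))"
  proof -
    have "(\<Sum>i<N. (real i + 2)\<^sup>2) / 8 + ?m / 16 = ?S / 4" by simp
    moreover have "\<sigma>\<^sup>2 / q * (S / 4) = \<sigma>\<^sup>2 * (S / q) / 4" for q S by simp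
    moreover have "(?p + 2 * L) / 2 * D\<^sup>2 = ?p * D\<^sup>2 / 2 + L * D\<^sup>2" by (simp add: field_simps)
    ultimately have "?m / 4 * e \<le> ?p * D\<^sup>2 / 2 + L * D\<^sup>2 + \<sigma>\<^sup>2 * (?S / (?p + L)) / 4"
      using gap by (simp only:)
    moreover have "m * x \<le> 2 * a + 4 * l + s" if "m / 4 * x \<le> a / 2 + l + s / 4" for m x a l s :: real
      using that by (simp add: field_simps)
    ultimately show ?thesis by (simp only: mult.assoc)
  qed
  also have "\<dots> \<le> 2 * (?m / ?r * D\<^sup>2) + 4 * L * D\<^sup>2 + \<sigma>\<^sup>2 * (?m / ?r) + 2 * L * \<sigma>\<^sup>2"
  proof -
    have "0 \<le> L * \<sigma>\<^sup>2" using L by simp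
    with S D show ?thesis by linarith
  qed
  also have "\<dots> = ?m * ((2 * D\<^sup>2 + \<sigma>\<^sup>2) / ?r + L * ((4 * D\<^sup>2 + 2 * \<sigma>\<^sup>2) / ?m))"
    by (simp add: algebra_simps add_divide_distrib)
  finally show ?thesis by simp
qed

theorem theorem1:
  fixes f h \<phi> :: "real ^ 'n \<Rightarrow> real"
    and grad_f :: "real ^ 'n \<Rightarrow> real ^ 'n"
    and F :: "real ^ 'n \<Rightarrow> 's \<Rightarrow> real"
    and G :: "real ^ 'n \<Rightarrow> 's \<Rightarrow> real ^ 'n"
    and P :: "'s measure"
    and M :: "'w measure"
    and \<xi> :: "nat \<Rightarrow> 'w \<Rightarrow> 's"
    and L \<sigma> D :: real
    and N :: nat
    and xstar :: "real ^ 'n"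
  assumes phi: "\<And>x. \<phi> x = f x + h x"
    and f_convex: "convex_on UNIV f"
    and f_grad: "\<And>x. GDERIV f x :> grad_f x"
    and L_pos: "L > 0"
    and grad_lipschitz: "L-lipschitz_on UNIV grad_f"
    and h_convex: "convex_on UNIV h"
    and P_prob: "prob_space P"
    and F_integrable: "\<And>x. integrable P (F x)"
    and f_expectation: "\<And>x. f x = (\<integral>s. F x s \<partial>P)"
    and G_measurable: "(\<lambda>(x, s). G x s) \<in> borel_measurable (borel \<Otimes>\<^sub>M P)"
    and G_integrable: "\<And>x. integrable P (G x)"
    and G_unbiased: "\<And>x. (\<integral>s. G x s \<partial>P) = grad_f x"
    and sigma_nonneg: "\<sigma> \<ge> 0"
    and G_sq_integrable: "\<And>x. integrable P (\<lambda>s. (norm (grad_f x - G x s))\<^sup>2)"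
    and G_variance: "\<And>x. (\<integral>s. (norm (grad_f x - G x s))\<^sup>2 \<partial>P) \<le> \<sigma>\<^sup>2"
    and optimal: "is_arg_min \<phi> (\<lambda>_. True) xstar"
    and N_ge: "N \<ge> 1"
    and M_prob: "prob_space M"
    and xi_indep: "prob_space.indep_vars M (\<lambda>_. P) \<xi> {0..N}"
    and xi_distr: "\<And>t. t \<le> N \<Longrightarrow> distr M P (\<xi> t) = P"
    and D_eq: "D = norm (xstar - 0)"
  shows "integrable M (\<lambda>\<omega>. \<phi> (sg_output N L h G (\<lambda>t. \<xi> t \<omega>)) - \<phi> xstar) \<and>
    (\<integral>\<omega>. (\<phi> (sg_output N L h G (\<lambda>t. \<xi> t \<omega>)) - \<phi> xstar) \<partial>M)
      \<le> (2 * D\<^sup>2 + \<sigma>\<^sup>2) / (real N + 2) powr (1/2)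
         + L * ((4 * D\<^sup>2 + 2 * \<sigma>\<^sup>2) / (real N + 2)\<^sup>2)"
proof -
  interpret prob_space M by (rule M_prob)
  interpret sg_run M f h grad_f G P \<xi> L \<sigma> N xstar
  proof unfold_locales
    show "f xstar + h xstar \<le> f x + h x" for x
      using optimal by (simp add: is_arg_min_linorder phi)
  qed (fact assms)+
  have out: "(\<lambda>\<omega>. \<phi> (sg_output N L h G (\<lambda>t. \<xi> t \<omega>)) - \<phi> xstar) = gap (Suc N)"
    by (simp add: fun_eq_iff gap_def state_def sg_output_def phi del: sg_state.simps)
  show ?thesis
    unfolding out D_eq diff_zero
    using gap_integrable rate_from_expected_gap[OF N_ge L_pos expected_gap[unfolded slack_weight_def step_weight_def]]
    by blast
qed

end
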